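(* Let $K\subset L$ be a field extension and let $A$, $B$ be two non-zero $n$-dimensional $K$-subspaces of $L$ such that $A$ is matched to $B$. Let $\mathcal{B}=\{b_1,\ldots,b_n\}$ be an ordered basis of $B$. For $b\in B$ define $A_b=\{a\in A:\ ab\in A\}$. Then $$\dim_K \bigcap_{i\in J} A_{b_i}\leq n-\#J$$ for any $J\subset\{1,\ldots,n\}$.
   Context: Let $A,B$ be $n$-dimensional $K$-subspaces of $L$. An ordered basis $\{a_1,\ldots,a_n\}$ of $A$ is said to be matched to an ordered basis $\{b_1,\ldots,b_n\}$ of $B$ if $a_i^{-1}A\cap B\subset\langle b_1,\ldots,\hat{b}_i,\ldots,b_n\rangle$ for each $1\le i\le n$, where $\langle b_1,\ldots,\hat b_i,\ldots,b_n\rangle$ is the $K$-span of $\{b_1,\ldots,b_n\}\setminus\{b_i\}$. The subspace $A$ is matched to the subspace $B$ if every ordered basis of $A$ can be matched to some ordered basis of $B$. Each $A_b$ is a $K$-subspace of $A$; intersections are taken inside $A$, so for $J=\emptyset$ the intersection is $A$. *)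

theory Defs
  imports "HOL-Algebra.Embedded_Algebras"
begin

definition (in ring) ordered_basis :: "'a set \<Rightarrow> 'a set \<Rightarrow> 'a list \<Rightarrow> bool"
  where "ordered_basis K E us \<longleftrightarrow> independent K us \<and> Span K us = E"

(* Only meaningful for ordered bases of the same length; indices start at 0.
   Since bs is distinct, removing all occurrences of "bs ! i" drops exactly
   the entry at position i. *)
definition (in field) matched_bases ::
    "'a set \<Rightarrow> 'a set \<Rightarrow> 'a set \<Rightarrow> 'a list \<Rightarrow> 'a list \<Rightarrow> bool"
  where "matched_bases K A B as bs \<longleftrightarrow>
    (\<forall>i < length as. ((inv (as ! i)) <# A) \<inter> B \<subseteq> Span K (removeAll (bs ! i) bs))"

(* A and B are meant to be K-subspaces of the same finite dimension, so that any
   two ordered bases as, bs below have the same length. *)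
definition (in field) matched_subspaces :: "'a set \<Rightarrow> 'a set \<Rightarrow> 'a set \<Rightarrow> bool"
  where "matched_subspaces K A B \<longleftrightarrow>
    (\<forall>as. ordered_basis K A as \<longrightarrow>
      (\<exists>bs. ordered_basis K B bs \<and> matched_bases K A B as bs))"

definition (in ring) mult_part :: "'a set \<Rightarrow> 'a \<Rightarrow> 'a set"
  where "mult_part A b = {a \<in> A. a \<otimes> b \<in> A}"

end

theory Submission
  imports Defs
begin

text \<open>
  Let \<open>U\<close> be the intersection of the spaces \<open>A\<^bsub>b\<^sub>i\<^esub>\<close> for \<open>i \<in> J\<close>, of dimension \<open>m\<close>. Extend an ordered
  basis of \<open>U\<close> to an ordered basis \<open>a\<close> of \<open>A\<close> and match it to a basis \<open>c\<close> of \<open>B\<close>. For \<open>i < m\<close> and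
  \<open>j \<in> J\<close> the product \<open>a\<^sub>i b\<^sub>j\<close> lies in \<open>A\<close>, so \<open>b\<^sub>j\<close> lies in the span of \<open>c\<close> without \<open>c\<^sub>i\<close>. Hence all
  \<open>b\<^sub>j\<close> lie in the span of the last \<open>n - m\<close> vectors of \<open>c\<close>, and since they are independent there are
  at most \<open>n - m\<close> of them.
\<close>

context ring
begin

text \<open>The order of \<open>vs\<close> is free: appending the entries of \<open>us\<close>
  missing from \<open>vs\<close> gives a rearrangement of \<open>us\<close>, and a prefix of an
  independent list is independent.\<close>

lemma independent_sublist:
  assumes K: "subfield K R" and "independent K us" "set vs \<subseteq> set us" "distinct vs"
  shows "independent K vs"
proof -
  define ws where "ws = filter (\<lambda>x. x \<notin> set vs) us"
  have "distinct us" using independent_distinct[OF K assms(2)] .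
  then have "distinct (vs @ ws)" "set us = set (vs @ ws)"
    using assms(3,4) by (auto simp: ws_def)
  moreover from this have "length us = length (vs @ ws)"
    using \<open>distinct us\<close> by (metis distinct_card)
  ultimately have "independent K (vs @ ws)"
    using independent_same_set[OF K] assms(2) by blast
  then show ?thesis using independent_split(2)[OF K] by blast
qed

text \<open>Write \<open>x\<close> as \<open>k \<otimes> u \<oplus> v\<close> with \<open>v\<close>
  in the span of \<open>vs\<close>. Both \<open>x\<close> and \<open>v\<close> avoid
  \<open>u\<close> in their expansions over \<open>us\<close>, so \<open>k \<otimes> u\<close> lies
  in the span of the other entries, and independence forces \<open>k = \<zero>\<close>.\<close>

lemma Span_Int_removeAll_Cons:
  assumes K: "subfield K R" and ind: "independent K us" and "u \<in> set us" "set (u # vs) \<subseteq> set us"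
    and "u \<notin> set vs"
    and x: "x \<in> Span K (u # vs)" "x \<in> Span K (removeAll u us)"
  shows "x \<in> Span K vs"
proof -
  let ?ws = "removeAll u us"
  have car: "set us \<subseteq> carrier R" using independent_in_carrier[OF ind] .
  then have ws: "set ?ws \<subseteq> carrier R" and vs: "set vs \<subseteq> carrier R" and u: "u \<in> carrier R"
    using assms(4) by auto
  have "independent K (u # ?ws)"
    using independent_sublist[OF K ind, of "u # ?ws"] independent_distinct[OF K ind] assms(3)
    by (auto simp: distinct_removeAll)
  then have notin: "u \<notin> Span K ?ws" by (rule independent_backwards)
  obtain k v where kv: "k \<in> K" "v \<in> Span K vs" "x = k \<otimes> u \<oplus> v"
    using x(1) by (auto simp: line_extension_mem_iff)
  have kc: "k \<in> carrier R" using kv(1) subfieldE(3)[OF K] by auto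
  have vc: "v \<in> carrier R"
    using Span_in_carrier[OF subfieldE(3)[OF K] vs] kv(2) by auto
  have "v \<in> Span K ?ws"
    using mono_Span_sublist[OF K, of vs ?ws] assms(4,5) ws kv(2) by auto
  then have "x \<oplus> (\<ominus> v) \<in> Span K ?ws"
    using x(2) Span_subgroup_props(3,4)[OF K ws] by blast
  moreover have "x \<oplus> (\<ominus> v) = k \<otimes> u" using kv(3) kc vc u by algebra
  ultimately have "k = \<zero>"
    using Span_m_inv_simprule[OF K ws, of k u] kv(1) u notin by auto
  then show ?thesis using kv vc u by simp
qed

text \<open>Induction on \<open>m\<close>: the previous lemma removes the head of
  \<open>drop m us\<close> at each step.\<close>

lemma Span_drop_if_Span_removeAll:
  assumes K: "subfield K R" and ind: "independent K us" and "x \<in> Span K us"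
    and "m \<le> length us" "\<And>i. i < m \<Longrightarrow> x \<in> Span K (removeAll (us ! i) us)"
  shows "x \<in> Span K (drop m us)"
  using assms(4,5)
proof (induction m)
  case 0
  then show ?case using assms(3) by simp
next
  case (Suc m)
  have d: "drop m us = us ! m # drop (Suc m) us"
    using Suc.prems(1) by (simp add: Cons_nth_drop_Suc)
  moreover have "us ! m \<notin> set (drop (Suc m) us)"
    using independent_distinct[OF K ind] d by (metis distinct.simps(2) distinct_drop)
  moreover have "x \<in> Span K (drop m us)" using Suc by simp
  moreover have "set (drop m us) \<subseteq> set us" by (rule set_drop_subset)
  ultimately show ?case
    using Span_Int_removeAll_Cons[OF K ind, of "us ! m" "drop (Suc m) us" x] Suc.prems
    by simp
qed

lemma subalgebra_mult_part_Inter: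
  assumes K: "subfield K R" and A: "subalgebra K A R" and "\<And>i. i \<in> J \<Longrightarrow> b i \<in> carrier R"
  shows "subalgebra K (A \<inter> (\<Inter>i\<in>J. mult_part A (b i))) R"
proof -
  interpret A: subalgebra K A R by (rule A)
  have carA: "A \<subseteq> carrier R" using subalgebra_in_carrier[OF A] .
  have Kc: "K \<subseteq> carrier R" using subfieldE(3)[OF K] .
  \<comment> \<open>A subalgebra is a subgroup of the additive monoid, so the inherited facts with
    multiplicative names speak of addition, and \<open>one_closed\<close> of zero.\<close>
  have sum: "x \<oplus> y \<in> A" if "x \<in> A" "y \<in> A" for x y using A.m_closed that by simp
  have neg: "\<ominus> x \<in> A" if "x \<in> A" for x using A.m_inv_closed that by (simp add: a_inv_def)
  have zero: "\<zero> \<in> A" using A.one_closed by simp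
  show ?thesis
  proof (intro subalgebra.intro add.subgroupI subalgebra_axioms.intro)
    fix x y assume "x \<in> A \<inter> (\<Inter>i\<in>J. mult_part A (b i))" "y \<in> A \<inter> (\<Inter>i\<in>J. mult_part A (b i))"
    then show "x \<oplus> y \<in> A \<inter> (\<Inter>i\<in>J. mult_part A (b i))"
      using assms(3) carA by (auto simp: mult_part_def sum l_distr subset_iff)
  next
    fix x assume "x \<in> A \<inter> (\<Inter>i\<in>J. mult_part A (b i))"
    then show "\<ominus> x \<in> A \<inter> (\<Inter>i\<in>J. mult_part A (b i))"
      using assms(3) carA by (auto simp: mult_part_def neg l_minus subset_iff)
  next
    fix k x assume "k \<in> K" "x \<in> A \<inter> (\<Inter>i\<in>J. mult_part A (b i))"
    then show "k \<otimes> x \<in> A \<inter> (\<Inter>i\<in>J. mult_part A (b i))"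
      using assms(3) carA Kc by (auto simp: mult_part_def A.smult_closed m_assoc subset_iff)
  next
    have "\<zero> \<in> A \<inter> (\<Inter>i\<in>J. mult_part A (b i))"
      using assms(3) zero by (auto simp: mult_part_def)
    then show "A \<inter> (\<Inter>i\<in>J. mult_part A (b i)) \<noteq> {}" by blast
  qed (use carA in auto)
qed

end

text \<open>This is how the matching is used: \<open>b\<close> is the inverse of
  \<open>as ! i\<close> times an element of \<open>A\<close>, hence lies in the intersection that
  the matching controls.\<close>

lemma (in field) matched_bases_mult_mem:
  assumes "matched_bases K A B as bs" and "i < length as" and "as ! i \<in> carrier R - {\<zero>}"
    and "b \<in> B" "b \<in> carrier R" and "as ! i \<otimes> b \<in> A"
  shows "b \<in> Span K (removeAll (bs ! i) bs)"
proof -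
  have "inv (as ! i) \<otimes> (as ! i \<otimes> b) = b"
    using assms(3,5) field_Units by (simp add: m_assoc[symmetric])
  then have "b \<in> inv (as ! i) <# A"
    using assms(6) unfolding l_coset_def by force
  then show ?thesis using assms(1,2,4) by (auto simp: matched_bases_def)
qed

theorem theorem3:
  fixes L :: "('a, 'm) ring_scheme" and K A B :: "'a set"
    and bs :: "'a list" and n :: nat and J :: "nat set"
  assumes "field L" and "subfield K L"
    and "ring.dimension L n K A" and "ring.dimension L n K B"
    and "A \<noteq> {\<zero>\<^bsub>L\<^esub>}" and "B \<noteq> {\<zero>\<^bsub>L\<^esub>}"
    and "field.matched_subspaces L K A B"
    and "ring.ordered_basis L K B bs"
    and "J \<subseteq> {..<n}"
  shows "int (ring.dim L K (A \<inter> (\<Inter>i\<in>J. ring.mult_part L A (bs ! i)))) \<le> int n - int (card J)"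
proof -
  interpret field L by fact
  note K = \<open>subfield K L\<close>
  define U where "U = A \<inter> (\<Inter>i\<in>J. mult_part A (bs ! i))"
  have bs: "independent K bs" "Span K bs = B" using assms(8) by (auto simp: ordered_basis_def)
  have bs_carrier: "set bs \<subseteq> carrier L" using independent_in_carrier[OF bs(1)] .
  have bs_B: "set bs \<subseteq> B" using Span_base_incl[OF K bs_carrier] bs(2) by simp
  have length_basis: "length us = n" if "ordered_basis K B us" for us
    using that dimension_is_inj[OF K assms(4)] dimension_independent
    unfolding ordered_basis_def by metis
  note len = length_basis[OF assms(8)]
  have finA: "finite_dimension K A" using finite_dimensionI[OF assms(3)] .
  have subA: "subalgebra K A L" using finite_dimension_imp_subalgebra[OF K finA] .
  have J: "bs ! j \<in> set bs" if "j \<in> J" for j using that assms(9) len by auto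
  then have "subalgebra K U L"
    unfolding U_def using bs_carrier by (intro subalgebra_mult_part_Inter[OF K subA]) auto
  then have "finite_dimension K U"
    by (rule subalbegra_incl_imp_finite_dimension[OF K finA]) (auto simp: U_def)
  then obtain m where m: "dimension m K U" by (rule finite_dimensionE')
  obtain us where us: "independent K us" "length us = m" "Span K us = U"
    using exists_base[OF K m] by blast
  have us_U: "set us \<subseteq> U"
    using Span_base_incl[OF K independent_in_carrier[OF us(1)]] us(3) by simp
  obtain vs where vs: "length (vs @ us) = n" "independent K (vs @ us)" "Span K (vs @ us) = A"
    using complete_base[OF K assms(3) us(1)] us_U by (auto simp: U_def)
  have car: "set (us @ vs) \<subseteq> carrier L" using independent_in_carrier[OF vs(2)] by auto
  \<comment> \<open>\<open>complete_base\<close> puts the new vectors in front. Moving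
    \<open>us\<close> to the front gives the basis of \<open>U\<close> the indices below
    \<open>m\<close>, exactly those removed by \<open>drop m cs\<close>.\<close>
  have "independent K (us @ vs)"
    using independent_same_set[OF K _ _ vs(2), of "us @ vs"] by auto
  moreover have "Span K (us @ vs) = A"
    using Span_same_set[OF K car, of "vs @ us"] vs(3) by auto
  ultimately have "ordered_basis K A (us @ vs)" by (simp add: ordered_basis_def)
  then obtain cs where cs: "ordered_basis K B cs" "matched_bases K A B (us @ vs) cs"
    using assms(7) by (auto simp: matched_subspaces_def)
  have cs': "independent K cs" "Span K cs = B" using cs(1) by (auto simp: ordered_basis_def)
  have mn: "m \<le> n" using vs(1) us(2) by simp
  have incl: "bs ! j \<in> Span K (drop m cs)" if j: "j \<in> J" for j
  proof (rule Span_drop_if_Span_removeAll[OF K cs'(1)])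
    show "bs ! j \<in> Span K cs" using J[OF j] bs_B cs'(2) by auto
    show "m \<le> length cs" using length_basis[OF cs(1)] mn by simp
    fix i assume i: "i < m"
    then have nth: "(us @ vs) ! i = us ! i" "us ! i \<in> set us"
      using us(2) by (auto simp: nth_append)
    \<comment> \<open>Otherwise the one-element list of zero would be independent, although zero
      lies in the span of the empty list.\<close>
    have "\<zero>\<^bsub>L\<^esub> \<notin> set us"
      using independent_sublist[OF K us(1), of "[\<zero>\<^bsub>L\<^esub>]"] independent_backwards(1)[of K "\<zero>\<^bsub>L\<^esub>" "[]"] by auto
    then have "us ! i \<in> carrier L - {\<zero>\<^bsub>L\<^esub>}" using nth(2) car by auto
    moreover have "us ! i \<otimes>\<^bsub>L\<^esub> bs ! j \<in> A"
      using nth(2) us_U j by (auto simp: U_def mult_part_def)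
    ultimately show "bs ! j \<in> Span K (removeAll (cs ! i) cs)"
      using matched_bases_mult_mem[OF cs(2), of i "bs ! j"] nth i us(2) J[OF j] bs_B bs_carrier
      by auto
  qed
  \<comment> \<open>\<open>nths bs J\<close> lists the \<open>bs ! j\<close> with \<open>j\<close>
    in \<open>J\<close>. Since \<open>J\<close> contains only valid indices, its length is
    \<open>card J\<close>.\<close>
  have "independent K (nths bs J)"
    using independent_sublist[OF K bs(1)] independent_distinct[OF K bs(1)]
    by (simp add: set_nths_subset distinct_nthsI)
  moreover have "independent K (drop m cs)"
    using independent_sublist[OF K cs'(1)] independent_distinct[OF K cs'(1)]
    by (simp add: set_drop_subset)
  moreover have "set (nths bs J) \<subseteq> Span K (drop m cs)"
    using incl by (auto simp: set_nths)
  ultimately have "length (nths bs J) \<le> length (drop m cs)"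
    by (rule independent_length_le[OF K])
  moreover have "{i. i < length bs \<and> i \<in> J} = J" using assms(9) len by auto
  ultimately have "card J \<le> n - m"
    using length_basis[OF cs(1)] by (simp add: length_nths)
  moreover have "dim K U = m" using dimI[OF K m] by (simp add: over_def)
  \<comment> \<open>By \<open>mn\<close> the natural-number difference \<open>n - m\<close> is not
    truncated, so the bound on \<open>card J\<close> carries over to integers.\<close>
  ultimately show ?thesis using mn by (simp add: U_def)
qed

end
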